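(* Let $d\in\{1,2\}$ and $\mu\in\{1,-1\}$. For $m,N\in\mathbb{N}$ define $\phi_{m,N}\in L^2(\mathbb{T}^d)$ by $$\phi_{m,N}(x):=N^{-\frac d2}\sum_{k\in\mathbb{Z}_N^d}e^{imk\cdot x},$$ and for a trigonometric polynomial $\phi$ on $\mathbb{T}^d$ and $t\ge 0$ set $$A[\phi](t):=-i\mu\int_0^t e^{i(t-t')\Delta}\Big[\,|e^{it'\Delta}\phi|^{\frac4d}\,e^{it'\Delta}\phi\,\Big]\,dt'.$$ Then there are constants $0<c\le C<\infty$, independent of $m$ and $N$, such that for all $m,N\in\mathbb{N}$, $$c\le \|\phi_{m,N}\|_{L^2(\mathbb{T}^d)}\le C\qquad\text{and}\qquad \Big\|A[\phi_{m,N}]\Big(\frac{2\pi}{m^2}\Big)\Big\|_{L^2(\mathbb{T}^d)}\ge \frac{c}{m^2}\log N .$$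
   Context: $\mathbb{N}=\{1,2,\dots\}$. $\mathbb{T}^d:=\mathbb{R}^d/(2\pi\mathbb{Z})^d$. $\mathbb{Z}_N^d:=\{(k_1,\dots,k_d)\in\mathbb{Z}^d : |k_j|\le N,\ 1\le j\le d\}$. $e^{it\Delta}$ denotes the free Schrödinger propagator on $\mathbb{T}^d$, i.e. the Fourier multiplier acting by $e^{it\Delta}e^{ik\cdot x}=e^{-i|k|^2t}e^{ik\cdot x}$ for $k\in\mathbb{Z}^d$. *)

theory Defs
  imports "HOL-Analysis.Analysis"
begin

text \<open>
  A function on the torus \<open>\<real>\<^sup>d / (2\<pi>\<int>)\<^sup>d\<close> is represented by its (periodic) lift to \<open>real ^ 'n\<close>,
  where \<open>d = CARD('n)\<close>. Integrals over the torus are Lebesgue integrals over the fundamental box;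
  the measure is not normalized, so that the torus has measure \<open>(2\<pi>)\<^sup>d\<close>.
  The norm below is \<open>0\<close> for a function that is not square-integrable, so a positive lower bound on it
  includes square-integrability.
\<close>

definition torus_box :: "(real ^ 'n) set"
  where "torus_box = cbox 0 (\<chi> j. 2 * pi)"

definition L2_norm_torus :: "(real ^ 'n \<Rightarrow> complex) \<Rightarrow> real"
  where "L2_norm_torus f = sqrt (LINT x:torus_box|lborel. (cmod (f x))\<^sup>2)"

definition freq :: "int ^ 'n \<Rightarrow> real ^ 'n"
  where "freq k = (\<chi> j. of_int (k $ j))"

definition torus_char :: "int ^ 'n \<Rightarrow> real ^ 'n \<Rightarrow> complex"
  where "torus_char k x = exp (\<i> * complex_of_real (freq k \<bullet> x))"

definition fourier_coeff :: "(real ^ 'n \<Rightarrow> complex) \<Rightarrow> int ^ 'n \<Rightarrow> complex"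
  where "fourier_coeff f k =
    (LINT x:torus_box|lborel. f x * torus_char (- k) x) / (2 * pi) ^ CARD('n)"

text \<open>
  The propagator \<open>e\<^sup>i\<^sup>t\<^sup>\<Delta>\<close> as a Fourier multiplier. The sum converges pointwise exactly when the Fourier
  coefficients are absolutely summable (otherwise \<open>infsum\<close> is \<open>0\<close>). This covers every trigonometric
  polynomial, see \<open>schroedinger_trig_poly\<close> below; for those the sum is finite. When \<open>4 / d\<close> is an
  even integer, i.e. for \<open>d\<close> equal to \<open>1\<close> or \<open>2\<close>, the nonlinearity \<open>\<bar>u\<bar>\<^sup>4\<^sup>/\<^sup>d u\<close> maps trigonometric
  polynomials to trigonometric polynomials.
\<close>

definition schroedinger :: "real \<Rightarrow> (real ^ 'n \<Rightarrow> complex) \<Rightarrow> real ^ 'n \<Rightarrow> complex"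
  where "schroedinger t f x =
    (\<Sum>\<^sub>\<infinity>k. exp (- \<i> * complex_of_real ((norm (freq k))\<^sup>2 * t)) * fourier_coeff f k * torus_char k x)"

definition nonlinearity :: "(real ^ 'n \<Rightarrow> complex) \<Rightarrow> real ^ 'n \<Rightarrow> complex"
  where "nonlinearity u x = complex_of_real (cmod (u x) powr (4 / real CARD('n))) * u x"

text \<open>
  The time integral is taken pointwise in \<open>x\<close>; for a trigonometric polynomial \<open>\<phi>\<close> the integrand is,
  for \<open>d\<close> equal to \<open>1\<close> or \<open>2\<close>, a finite sum of characters with coefficients continuous in \<open>t'\<close>, so
  this is the \<open>L\<^sup>2\<close>-valued integral.
\<close>

definition duhamel :: "real \<Rightarrow> (real ^ 'n \<Rightarrow> complex) \<Rightarrow> real \<Rightarrow> real ^ 'n \<Rightarrow> complex"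
  where "duhamel \<mu> \<phi> t x =
    - \<i> * complex_of_real \<mu> *
      (LINT t':{0..t}|lborel. schroedinger (t - t') (nonlinearity (schroedinger t' \<phi>)) x)"

definition freq_box :: "nat \<Rightarrow> (int ^ 'n) set"
  where "freq_box N = {k. \<forall>j. \<bar>k $ j\<bar> \<le> int N}"

definition phi :: "nat \<Rightarrow> nat \<Rightarrow> real ^ 'n \<Rightarrow> complex"
  where "phi m N x =
    complex_of_real (real N powr (- (real CARD('n) / 2))) *
      (\<Sum>k\<in>freq_box N. exp (\<i> * complex_of_real (real m * (freq k \<bullet> x))))"


lemma integral_exp_period:
  fixes n :: int
  shows "(LINT y:{0..2*pi}|lborel. exp (\<i> * complex_of_real (of_int n * y))) =
    (if n = 0 then complex_of_real (2 * pi) else 0)"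
proof (cases "n = 0")
  case True
  then show ?thesis by (simp add: set_integral_const scaleR_conv_of_real)
next
  case False
  have c: "continuous_on {0..2*pi} (\<lambda>y. exp (\<i> * complex_of_real (of_int n * y)))"
    by (intro continuous_intros)
  have "((\<lambda>y. exp (\<i> * complex_of_real (of_int n * y))) has_integral
      exp (\<i> * complex_of_real (of_int n * (2*pi))) / (\<i> * of_int n) -
      exp (\<i> * complex_of_real (of_int n * 0)) / (\<i> * of_int n)) {0..2*pi}"
  proof (rule fundamental_theorem_of_calculus)
    fix y :: real
    have "((\<lambda>z. exp (\<i> * (of_int n * z)) / (\<i> * of_int n)) has_field_derivative
        exp (\<i> * (of_int n * complex_of_real y))) (at (complex_of_real y))"
      using False by (auto intro!: derivative_eq_intros simp: field_simps)
    from has_vector_derivative_real_field[OF this]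
    show "((\<lambda>y. exp (\<i> * complex_of_real (of_int n * y)) / (\<i> * of_int n)) has_vector_derivative
        exp (\<i> * complex_of_real (of_int n * y))) (at y within {0..2*pi})"
      by simp
  qed simp
  moreover have "exp (\<i> * complex_of_real (of_int n * (2*pi))) = 1"
    using exp_integer_2pi[of "of_int n"] by (simp add: mult_ac)
  ultimately have "((\<lambda>y. exp (\<i> * complex_of_real (of_int n * y))) has_integral 0) {0..2*pi}"
    by simp
  moreover have "set_integrable lborel {0..2*pi} (\<lambda>y. exp (\<i> * complex_of_real (of_int n * y)))"
    using c by (rule borel_integrable_atLeastAtMost')
  ultimately show ?thesis
    using False by (metis integral_unique set_borel_integral_eq_integral(2))
qed

lemma integral_torus_char:
  fixes k :: "int ^ 'n"
  shows "(LINT x:torus_box|lborel. torus_char k x) = (if k = 0 then (2 * pi) ^ CARD('n) else 0)"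
proof -
  interpret product_sigma_finite "\<lambda>b::real^'n. lborel :: real measure" ..
  define F where "F b y = indicat_real {0..2*pi} y *\<^sub>R exp (\<i> * complex_of_real (freq k \<bullet> b * y))"
    for b :: "real^'n" and y
  have int: "integrable lborel (F b)" for b
    unfolding F_def
    using borel_integrable_atLeastAtMost'[of 0 "2*pi" "\<lambda>y. exp (\<i> * complex_of_real (freq k \<bullet> b * y))"]
    by (simp add: set_integrable_def continuous_intros)
  have split: "indicat_real torus_box (\<Sum>b\<in>Basis. f b *\<^sub>R b) *\<^sub>R torus_char k (\<Sum>b\<in>Basis. f b *\<^sub>R b)
     = (\<Prod>b\<in>Basis. F b (f b))" for f :: "real^'n \<Rightarrow> real"
  proof -
    have "(\<Sum>b\<in>Basis. f b *\<^sub>R b) \<in> torus_box \<longleftrightarrow> (\<forall>b\<in>Basis. f b \<in> {0..2*pi})"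
    proof -
      have "(\<chi> j. 2 * pi) \<bullet> b = 2 * pi" if "b \<in> Basis" for b :: "real^'n"
        using that by (auto simp: Basis_vec_def inner_axis)
      then show ?thesis by (simp add: torus_box_def mem_box)
    qed
    then have "indicat_real torus_box (\<Sum>b\<in>Basis. f b *\<^sub>R b) = (\<Prod>b\<in>Basis. indicat_real {0..2*pi} (f b))"
      by (auto simp: indicator_def)
    moreover have "torus_char k (\<Sum>b\<in>Basis. f b *\<^sub>R b) =
        (\<Prod>b\<in>Basis. exp (\<i> * complex_of_real (freq k \<bullet> b * f b)))"
      by (simp add: torus_char_def inner_sum_right sum_distrib_left mult_ac flip: exp_sum)
    ultimately show ?thesis
      by (simp add: F_def scaleR_conv_of_real prod.distrib)
  qed
  have "(LINT x:torus_box|lborel. torus_char k x) =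
      (\<integral>x. indicat_real torus_box x *\<^sub>R torus_char k x
        \<partial>distr (\<Pi>\<^sub>M b\<in>Basis. lborel) borel (\<lambda>f. \<Sum>b\<in>Basis. f b *\<^sub>R b))"
    unfolding set_lebesgue_integral_def by (subst lborel_eq) (rule refl)
  also have "\<dots> = (\<integral>f. (\<Prod>b\<in>Basis. F b (f b)) \<partial>(\<Pi>\<^sub>M b\<in>Basis. lborel))"
  proof (subst integral_distr)
    have "continuous_on UNIV (torus_char k)"
      unfolding torus_char_def by (intro continuous_intros)
    then have "torus_char k \<in> borel_measurable borel"
      by (rule borel_measurable_continuous_onI)
    then show "(\<lambda>x. indicat_real torus_box x *\<^sub>R torus_char k x) \<in> borel_measurable borel"
      unfolding torus_box_def by measurable
  qed (auto simp: split)
  also have "\<dots> = (\<Prod>b\<in>Basis. integral\<^sup>L lborel (F b))"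
    by (rule product_integral_prod) (auto simp: int)
  also have "\<dots> = (\<Prod>j\<in>UNIV. integral\<^sup>L lborel (F (axis j 1)))"
  proof -
    have "inj_on (\<lambda>j::'n. axis j (1::real)) UNIV"
      by (simp add: inj_on_def axis_eq_axis)
    moreover have "(Basis :: (real^'n) set) = (\<lambda>j. axis j 1) ` UNIV"
      by (auto simp: Basis_vec_def)
    ultimately show ?thesis
      using prod.reindex[of "\<lambda>j::'n. axis j (1::real)" UNIV "\<lambda>b. integral\<^sup>L lborel (F b)"]
      by (simp only: o_def)
  qed
  also have "\<dots> = (\<Prod>j\<in>UNIV. if k $ j = 0 then complex_of_real (2 * pi) else 0)"
    unfolding F_def using integral_exp_period
    by (simp add: freq_def inner_axis set_lebesgue_integral_def)
  also have "\<dots> = (if k = 0 then (2 * pi) ^ CARD('n) else 0)"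
    by (auto simp: vec_eq_iff)
  finally show ?thesis .
qed

lemma fourier_coeff_trig_poly:
  fixes a :: "int ^ 'n \<Rightarrow> complex"
  assumes "finite S"
  shows "fourier_coeff (\<lambda>x. \<Sum>l\<in>S. a l * torus_char l x) k = (if k \<in> S then a k else 0)"
proof -
  have mul: "torus_char l x * torus_char (- k) x = torus_char (l - k) x" for l and x :: "real^'n"
    by (simp add: torus_char_def freq_def inner_vec_def sum_negf sum_subtractf algebra_simps
        flip: exp_add)
  have int: "set_integrable lborel torus_box (torus_char l)" for l :: "int^'n"
    unfolding torus_box_def torus_char_def set_integrable_def
    by (rule borel_integrable_compact) (auto intro!: continuous_intros)
  have "(LINT x:torus_box|lborel. (\<Sum>l\<in>S. a l * torus_char l x) * torus_char (- k) x) =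
      (LINT x:torus_box|lborel. (\<Sum>l\<in>S. a l * torus_char (l - k) x))"
    by (simp add: sum_distrib_right mult.assoc mul)
  also have "\<dots> = (\<Sum>l\<in>S. a l * (LINT x:torus_box|lborel. torus_char (l - k) x))"
    using int unfolding set_lebesgue_integral_def set_integrable_def
    by (simp add: scaleR_sum_right Bochner_Integration.integral_sum flip: mult_scaleR_right)
  also have "\<dots> = (\<Sum>l\<in>S. if l = k then a l * (2 * pi) ^ CARD('n) else 0)"
    by (intro sum.cong) (auto simp: integral_torus_char)
  finally show ?thesis
    using assms by (simp add: fourier_coeff_def)
qed

lemma schroedinger_trig_poly:
  fixes a :: "int ^ 'n \<Rightarrow> complex"
  assumes "finite S"
  shows "schroedinger t (\<lambda>x. \<Sum>l\<in>S. a l * torus_char l x) x =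
    (\<Sum>k\<in>S. exp (- \<i> * complex_of_real ((norm (freq k))\<^sup>2 * t)) * a k * torus_char k x)"
proof -
  have "schroedinger t (\<lambda>x. \<Sum>l\<in>S. a l * torus_char l x) x =
    (\<Sum>\<^sub>\<infinity>k\<in>S. exp (- \<i> * complex_of_real ((norm (freq k))\<^sup>2 * t)) * a k * torus_char k x)"
    unfolding schroedinger_def fourier_coeff_trig_poly[OF assms]
    by (rule infsum_cong_neutral) auto
  then show ?thesis using assms by simp
qed

end

theory Submission
  imports Defs "HOL-Number_Theory.Totient"
begin

text \<open>
  Let \<open>p = 4/d + 1\<close>, that is, \<open>p = 5\<close> for \<open>d = 1\<close> and \<open>p = 3\<close> for \<open>d = 2\<close>. Since \<open>4/d\<close> is even, the
  nonlinearity of the free solution is a product of \<open>p\<close> factors \<open>u\<close> and \<open>cnj u\<close>, hence a finite sum of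
  plane waves, one for each \<open>p\<close>-tuple of frequencies \<open>k\<^sub>1, k\<^sub>2, \<dots>\<close> in the box. The wave of such a tuple has
  frequency \<open>m (k\<^sub>1 - k\<^sub>2 + k\<^sub>3 - \<dots>)\<close> and oscillates in time with phase
  \<open>m\<^sup>2 (\<bar>k\<^sub>1\<bar>\<^sup>2 - \<bar>k\<^sub>2\<bar>\<^sup>2 + \<bar>k\<^sub>3\<bar>\<^sup>2 - \<dots>)\<close>. The time \<open>T = 2\<pi>/m\<^sup>2\<close> is a common period of all these
  oscillations, so the Duhamel integral annihilates every tuple whose phase is not \<open>m\<^sup>2 \<bar>k\<bar>\<^sup>2\<close>, where
  \<open>k = k\<^sub>1 - k\<^sub>2 + k\<^sub>3 - \<dots>\<close>, and multiplies the remaining, resonant ones by \<open>T\<close>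
  (\<open>duhamel_eq_resonant_sum\<close>). Hence the Fourier coefficient of \<open>A[\<phi>]\<close> at \<open>m k\<close> has absolute value
  \<open>T N\<^bsup>-dp/2\<^esup> r(k)\<close>, where \<open>r(k)\<close> counts the resonant tuples of \<open>k\<close>. All contributions have the same
  argument, so nothing cancels, and the theorem becomes a lower bound for \<open>r(k)\<close>.

  It is enough to show \<open>r(k) \<ge> c N\<^sup>2 log N\<close> for the \<open>\<ge> N\<^sup>d\<close> frequencies \<open>k\<close> of the half-sized box: by
  Parseval the squared norm is then at least a constant times
  \<open>T\<^sup>2 N\<^bsup>-dp\<^esup> N\<^sup>d (N\<^sup>2 log N)\<^sup>2 = T\<^sup>2 (log N)\<^sup>2\<close>, because \<open>d (p - 1) = 4\<close>.

  In both dimensions, resonant tuples are produced from pairs of orthogonal vectors of \<open>\<int>\<^sup>2\<close>. Shifting all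
  frequencies by \<open>k\<close> preserves resonance, so one may think of \<open>k = 0\<close>. For \<open>d = 2\<close> the resonant triples
  are then the rectangles \<open>0, u, u + v, v\<close> with \<open>u\<close> and \<open>v\<close> orthogonal. For \<open>d = 1\<close> a linear
  substitution turns the system \<open>x + y + z = u + v\<close>, \<open>x\<^sup>2 + y\<^sup>2 + z\<^sup>2 = u\<^sup>2 + v\<^sup>2\<close> into the same
  equation \<open>a c + b d = 0\<close> (\<open>orthogonal_pairs_le_quintic_resonances\<close>).

  Finally, the number of orthogonal pairs with entries at most \<open>M\<close> is at least a constant times
  \<open>M\<^sup>2 log M\<close>: each primitive direction \<open>(p, q)\<close> with \<open>1 \<le> q \<le> p\<close> contributes about \<open>(M/p)\<^sup>2\<close> pairs of
  multiples of \<open>(p, q)\<close> and \<open>(-q, p)\<close>, and there are \<open>\<phi>(p)\<close> such directions for each \<open>p\<close>. The sum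
  \<open>\<Sum> \<phi>(p)/p\<^sup>2\<close> is bounded below by a multiple of the harmonic sum (\<open>harm_le_totient_sum\<close>).
\<close>

section \<open>Orthogonal pairs of lattice vectors\<close>

text \<open>
  The tuple \<open>(a, b, c, d)\<close> stands for the pair of vectors \<open>(a, b)\<close> and \<open>(c, d)\<close> of \<open>\<int>\<^sup>2\<close>.
\<close>

definition orthogonal_pairs :: "nat \<Rightarrow> (int \<times> int \<times> int \<times> int) set"
  where "orthogonal_pairs M =
    {(a, b, c, d). \<bar>a\<bar> \<le> int M \<and> \<bar>b\<bar> \<le> int M \<and> \<bar>c\<bar> \<le> int M \<and> \<bar>d\<bar> \<le> int M \<and> a * c + b * d = 0}"

lemma finite_orthogonal_pairs: "finite (orthogonal_pairs M)"
proof (rule finite_subset)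
  show "orthogonal_pairs M \<subseteq> {-int M..int M} \<times> {-int M..int M} \<times> {-int M..int M} \<times> {-int M..int M}"
    by (auto simp: orthogonal_pairs_def)
qed auto

text \<open>
  The pairs whose first vector is \<open>0\<close>. This bound without a logarithm absorbs the additive constant that
  arises when \<open>ln N\<close> is compared with the logarithm of a fixed fraction of \<open>N\<close>.
\<close>

lemma card_orthogonal_pairs_ge_square: "(M + 1)\<^sup>2 \<le> card (orthogonal_pairs M)"
proof -
  have "card ({0..int M} \<times> {0..int M}) \<le> card (orthogonal_pairs M)"
    by (rule card_inj_on_le[where f = "\<lambda>(c, d). (0, 0, c, d)"])
      (auto simp: inj_on_def finite_orthogonal_pairs, simp add: orthogonal_pairs_def)
  then show ?thesis by (simp add: power2_eq_square nat_add_distrib)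
qed

text \<open>
  The pairs counted are \<open>s (p, q)\<close>, \<open>t (- q, p)\<close> with \<open>q \<le> p\<close> coprime to \<open>p\<close> and \<open>1 \<le> s, t \<le> M / p\<close>. No pair
  is counted twice: \<open>s\<close> is the gcd of the entries of the first vector, which then determines \<open>(p, q)\<close>.
\<close>

lemma card_orthogonal_pairs_ge_totient_sum:
  "(\<Sum>p=1..M. totient p * (M div p)\<^sup>2) \<le> card (orthogonal_pairs M)"
proof -
  define S where "S = (SIGMA p:{1..M}. totatives p \<times> {1..M div p} \<times> {1..M div p})"
  define f where "f = (\<lambda>(p, q, s, t). (int (s * p), int (s * q), - int (t * q), int (t * p)))"
  have "card S = (\<Sum>p=1..M. totient p * (M div p)\<^sup>2)"
    by (simp add: S_def card_SigmaI totient_def power2_eq_square)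
  moreover have "card S \<le> card (orthogonal_pairs M)"
  proof (rule card_inj_on_le)
    show "inj_on f S"
    proof (rule inj_onI)
      fix x y assume xy: "x \<in> S" "y \<in> S" "f x = f y"
      obtain p q s t where x: "x = (p, q, s, t)" by (metis prod_cases4)
      obtain p' q' s' t' where y: "y = (p', q', s', t')" by (metis prod_cases4)
      have co: "coprime p q" "coprime p' q'" and pos: "0 < p" "0 < s" "0 < p'" "0 < s'"
        using xy by (auto simp: S_def x y totatives_def coprime_commute)
      have eqs: "s * p = s' * p'" "s * q = s' * q'" "t * p = t' * p'"
        using xy(3) unfolding f_def x y by (simp_all only: prod.case prod.inject of_nat_eq_iff neg_equal_iff_equal)
      have "gcd (s * p) (s * q) = s" "gcd (s' * p') (s' * q') = s'"
        using co by (simp_all flip: gcd_mult_distrib_nat)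
      then have "s = s'" using eqs by simp
      then show "x = y" using eqs pos by (simp add: x y)
    qed
    show "f ` S \<subseteq> orthogonal_pairs M"
    proof
      fix z assume "z \<in> f ` S"
      then obtain p q s t where z: "z = f (p, q, s, t)" and S: "(p, q, s, t) \<in> S"
        by auto
      have "q \<le> p" "s * p \<le> M" "t * p \<le> M"
        using S by (auto simp: S_def totatives_def less_eq_div_iff_mult_less_eq)
      moreover from this have "s * q \<le> M" "t * q \<le> M"
        by (meson le_trans mult_le_mono2)+
      ultimately show "z \<in> orthogonal_pairs M"
        unfolding z f_def orthogonal_pairs_def
        by (simp del: of_nat_mult) (simp add: algebra_simps)
    qed
  qed (rule finite_orthogonal_pairs)
  ultimately show ?thesis by simp
qed

text \<open>
  By induction the sum is at most the telescoping bound \<open>2 - 1/n\<close>.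
\<close>

lemma sum_inverse_squares_le: "(\<Sum>j=1..n. 1 / (real j)\<^sup>2) \<le> 2"
proof (cases "n = 0")
  case False
  then have "0 < n" by simp
  then have "(\<Sum>j=1..n. 1 / (real j)\<^sup>2) \<le> 2 - 1 / real n"
  proof (induction n rule: nat_induct_non_zero)
    case (Suc n)
    have "1 / (real (Suc n))\<^sup>2 \<le> 1 / (real n * real (Suc n))"
      using Suc by (intro divide_left_mono) (auto simp: power2_eq_square)
    also have "\<dots> = 1 / real n - 1 / real (Suc n)"
      using Suc by (simp add: field_simps)
    finally show ?case using Suc by simp
  qed simp
  then show ?thesis by (smt (verit) divide_nonneg_nonneg of_nat_0_le_iff)
qed simp

text \<open>
  Write \<open>1/k = (\<Sum>e dvd k. \<phi>(e)) / k\<^sup>2\<close> and exchange the sums: the multiples \<open>k = e j\<close> of \<open>e\<close> contribute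
  \<open>\<phi>(e)/e\<^sup>2 \<cdot> \<Sum> 1/j\<^sup>2\<close>, and the inner sum is at most \<open>2\<close>. This gives the right order of growth
  without any information on the density of coprime pairs.
\<close>

lemma harm_le_totient_sum: "harm n \<le> 2 * (\<Sum>e=1..n. real (totient e) / (real e)\<^sup>2)"
proof -
  have "harm n = (\<Sum>k=1..n. \<Sum>e | e \<in> {1..n} \<and> e dvd k. real (totient e) / (real k)\<^sup>2)"
    unfolding harm_def
  proof (rule sum.cong)
    fix k assume k: "k \<in> {1..n}"
    then have "{e. e \<in> {1..n} \<and> e dvd k} = {e. e dvd k}"
      by (auto dest: dvd_imp_le intro: Suc_leI dvd_pos_nat)
    then have "(\<Sum>e | e \<in> {1..n} \<and> e dvd k. real (totient e) / (real k)\<^sup>2) = real (\<Sum>e | e dvd k. totient e) / (real k)\<^sup>2"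
      by (simp add: sum_divide_distrib)
    also have "\<dots> = inverse (real k)"
      using k by (simp add: totient_divisor_sum power2_eq_square field_simps)
    finally show "inverse (real k) = (\<Sum>e | e \<in> {1..n} \<and> e dvd k. real (totient e) / (real k)\<^sup>2)" ..
  qed simp
  also have "\<dots> = (\<Sum>e=1..n. \<Sum>k | k \<in> {1..n} \<and> e dvd k. real (totient e) / (real k)\<^sup>2)"
    by (rule sum.swap_restrict) auto
  also have "\<dots> \<le> (\<Sum>e=1..n. 2 * (real (totient e) / (real e)\<^sup>2))"
  proof (rule sum_mono)
    fix e assume e: "e \<in> {1..n}"
    have "{k. k \<in> {1..n} \<and> e dvd k} = (\<lambda>j. e * j) ` {1..n div e}"
    proof (intro set_eqI iffI)
      fix k assume "k \<in> {k. k \<in> {1..n} \<and> e dvd k}"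
      then obtain j where "k = e * j" "1 \<le> e * j" "e * j \<le> n" by (auto simp: dvd_def)
      moreover from this have "1 \<le> j" by (cases j) auto
      ultimately show "k \<in> (\<lambda>j. e * j) ` {1..n div e}"
        using e by (auto simp: less_eq_div_iff_mult_less_eq mult.commute)
    qed (use e in \<open>auto simp: less_eq_div_iff_mult_less_eq mult.commute\<close>)
    then have "(\<Sum>k | k \<in> {1..n} \<and> e dvd k. real (totient e) / (real k)\<^sup>2) =
        (\<Sum>j=1..n div e. real (totient e) / (real (e * j))\<^sup>2)"
      using e by (simp add: sum.reindex inj_on_def)
    also have "\<dots> = real (totient e) / (real e)\<^sup>2 * (\<Sum>j=1..n div e. 1 / (real j)\<^sup>2)"
      by (simp add: sum_distrib_left power_mult_distrib)
    also have "\<dots> \<le> real (totient e) / (real e)\<^sup>2 * 2"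
      by (intro mult_left_mono sum_inverse_squares_le) auto
    also have "\<dots> = 2 * (real (totient e) / (real e)\<^sup>2)" by simp
    finally show "(\<Sum>k | k \<in> {1..n} \<and> e dvd k. real (totient e) / (real k)\<^sup>2) \<le> 2 * (real (totient e) / (real e)\<^sup>2)" .
  qed
  finally show ?thesis by (simp add: sum_distrib_left)
qed

lemma card_orthogonal_pairs_ge_log:
  "(real M)\<^sup>2 * ln (real M + 1) \<le> 8 * real (card (orthogonal_pairs M))"
proof -
  have "(real M)\<^sup>2 * ln (real M + 1) \<le> (real M)\<^sup>2 * (2 * (\<Sum>p=1..M. real (totient p) / (real p)\<^sup>2))"
    using ln_le_harm[of M] harm_le_totient_sum[of M] by (intro mult_left_mono) (auto simp: add.commute)
  also have "\<dots> = (\<Sum>p=1..M. 2 * (real (totient p) * (real M / real p)\<^sup>2))"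
    by (simp add: sum_distrib_left power_divide mult_ac)
  also have "\<dots> \<le> (\<Sum>p=1..M. 8 * real (totient p * (M div p)\<^sup>2))"
  proof (rule sum_mono)
    fix p assume p: "p \<in> {1..M}"
    \<comment> \<open>Rounding loses at most a factor 2: \<open>M div p \<ge> M / (2 p)\<close> as soon as \<open>p \<le> M\<close>.\<close>
    have "M < p * (M div p) + p" "p \<le> p * (M div p)"
      using p dividend_less_times_div[of p M] by (auto simp: Suc_leI div_greater_zero_iff)
    then have "M \<le> 2 * (p * (M div p))" by linarith
    then have "real M \<le> real (2 * (p * (M div p)))" by (simp only: of_nat_le_iff)
    then have "real M / real p \<le> 2 * real (M div p)"
      using p by (simp add: divide_simps mult_ac)
    then have "(real M / real p)\<^sup>2 \<le> (2 * real (M div p))\<^sup>2"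
      by (intro power_mono) auto
    then have "real (totient p) * (real M / real p)\<^sup>2 \<le> real (totient p) * (2 * real (M div p))\<^sup>2"
      by (intro mult_left_mono) auto
    then show "2 * (real (totient p) * (real M / real p)\<^sup>2) \<le> 8 * real (totient p * (M div p)\<^sup>2)"
      by (simp add: power_mult_distrib)
  qed
  also have "\<dots> = 8 * real (\<Sum>p=1..M. totient p * (M div p)\<^sup>2)"
    by (simp add: sum_distrib_left)
  also have "\<dots> \<le> 8 * real (card (orthogonal_pairs M))"
    using card_orthogonal_pairs_ge_totient_sum[of M] by (simp only: of_nat_le_iff mult_le_cancel_left) simp
  finally show ?thesis .
qed

text \<open>
  A form without exceptions for small \<open>N\<close>. With \<open>M = N div 6\<close> one has \<open>N \<le> 6 (M + 1)\<close> and
  \<open>ln N \<le> 2 + ln (M + 1)\<close>. The constant \<open>2\<close> and the logarithm are paid for by the quadratic and by the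
  logarithmic bound on the number \<open>R\<close> of orthogonal pairs, in total \<open>36 \<cdot> (2 + 32) R = 1224 R\<close>. The divisor \<open>6\<close>
  is what the one-dimensional parametrization of resonances needs.
\<close>

lemma card_orthogonal_pairs_ge:
  assumes "1 \<le> N"
  shows "(real N)\<^sup>2 * ln (real N) \<le> 1224 * real (card (orthogonal_pairs (N div 6)))"
proof -
  define M where "M = N div 6"
  define R where "R = real (card (orthogonal_pairs M))"
  have R1: "(real M + 1)\<^sup>2 \<le> R"
  proof -
    have "real ((M + 1)\<^sup>2) \<le> R" unfolding R_def using card_orthogonal_pairs_ge_square by (rule of_nat_mono)
    then show ?thesis by (simp add: add.commute)
  qed
  have R2: "(real M + 1)\<^sup>2 * ln (real M + 1) \<le> 32 * R"
  proof (cases "M = 0")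
    case False
    have "(real M + 1)\<^sup>2 \<le> (2 * real M)\<^sup>2" using False by (intro power_mono) auto
    then have "(real M + 1)\<^sup>2 * ln (real M + 1) \<le> (2 * real M)\<^sup>2 * ln (real M + 1)"
      by (intro mult_right_mono) auto
    also have "\<dots> = 4 * ((real M)\<^sup>2 * ln (real M + 1))" by (simp add: power_mult_distrib)
    also have "\<dots> \<le> 32 * R" using card_orthogonal_pairs_ge_log[of M] by (simp add: R_def mult.commute)
    finally show ?thesis .
  qed (simp add: R_def)
  have "N \<le> 6 * (M + 1)" unfolding M_def by presburger
  then have "real N \<le> real (6 * (M + 1))" by (rule of_nat_mono)
  then have N: "real N \<le> 6 * (real M + 1)" by simp
  have "(6::real) \<le> exp 2"
  proof -
    have "(2.5::real) ^ 2 \<le> exp 1 ^ 2" using exp_lower_Taylor_quadratic[of 1] by (intro power_mono) auto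
    then show ?thesis by (simp flip: exp_of_nat_mult) (simp add: power2_eq_square)
  qed
  then have "ln (6::real) \<le> 2" by (metis exp_gt_zero ln_exp ln_le_cancel_iff zero_less_numeral)
  moreover have "ln (real N) \<le> ln (6 * (real M + 1))" using N assms by simp
  moreover have "ln (6 * (real M + 1)) = ln 6 + ln (real M + 1)" by (rule ln_mult_pos) auto
  ultimately have lnN: "ln (real N) \<le> 2 + ln (real M + 1)" by linarith
  have "(real N)\<^sup>2 * ln (real N) \<le> (6 * (real M + 1))\<^sup>2 * (2 + ln (real M + 1))"
    using N lnN assms by (intro mult_mono power_mono) auto
  also have "\<dots> = 36 * (2 * (real M + 1)\<^sup>2 + (real M + 1)\<^sup>2 * ln (real M + 1))"
    by (simp only: power_mult_distrib) (simp add: algebra_simps)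
  also have "\<dots> \<le> 36 * (2 * R + 32 * R)" using R1 R2 by simp
  finally show ?thesis by (simp add: R_def M_def)
qed

section \<open>Trigonometric sums on the torus and the resonant part of the Duhamel term\<close>

text \<open>
  The integer-valued \<open>\<bar>k\<bar>\<^sup>2\<close>, so that resonance is an equation between integers.
\<close>

definition sq_norm :: "int ^ 'n \<Rightarrow> int"
  where "sq_norm k = (\<Sum>j\<in>UNIV. (k $ j)\<^sup>2)"

lemma norm_freq_square: "(norm (freq k))\<^sup>2 = of_int (sq_norm k)"
  unfolding power2_norm_eq_inner by (simp add: freq_def inner_vec_def sq_norm_def power2_eq_square)

lemma sq_norm_scale: "sq_norm (a *s k) = a\<^sup>2 * sq_norm k"
  by (simp add: sq_norm_def power_mult_distrib sum_distrib_left)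

text \<open>
  The sums over tuples of frequencies are indexed by a map \<open>\<kappa>\<close> that is far from injective; collecting equal
  frequencies gives a genuine trigonometric polynomial.
\<close>

lemma sum_torus_char_regroup:
  fixes a :: "'i \<Rightarrow> complex"
  assumes "finite I"
  shows "(\<Sum>i\<in>I. a i * torus_char (\<kappa> i) x) =
    (\<Sum>l\<in>\<kappa> ` I. (\<Sum>i | i \<in> I \<and> \<kappa> i = l. a i) * torus_char l x)"
  unfolding sum_distrib_right
  by (subst sum.image_gen[OF assms, of _ \<kappa>]) (auto intro!: sum.cong)

lemma schroedinger_char_sum:
  fixes a :: "'i \<Rightarrow> complex" and \<kappa> :: "'i \<Rightarrow> int ^ 'n"
  assumes "finite I"
  shows "schroedinger t (\<lambda>x. \<Sum>i\<in>I. a i * torus_char (\<kappa> i) x) x =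
    (\<Sum>i\<in>I. exp (- \<i> * complex_of_real (of_int (sq_norm (\<kappa> i)) * t)) * a i * torus_char (\<kappa> i) x)"
proof -
  define e where "e l = exp (- \<i> * complex_of_real (of_int (sq_norm l) * t))" for l :: "int ^ 'n"
  have "schroedinger t (\<lambda>x. \<Sum>i\<in>I. a i * torus_char (\<kappa> i) x) x =
      (\<Sum>l\<in>\<kappa> ` I. e l * (\<Sum>i | i \<in> I \<and> \<kappa> i = l. a i) * torus_char l x)"
    unfolding sum_torus_char_regroup[OF assms]
    using assms by (subst schroedinger_trig_poly) (simp_all add: norm_freq_square e_def)
  also have "\<dots> = (\<Sum>i\<in>I. e (\<kappa> i) * a i * torus_char (\<kappa> i) x)"
    unfolding sum_torus_char_regroup[OF assms]
    by (intro sum.cong refl) (simp add: sum_distrib_left)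
  finally show ?thesis by (simp add: e_def)
qed

lemma cnj_torus_char: "cnj (torus_char k x) = torus_char (- k) x"
  by (simp add: torus_char_def exp_cnj freq_def inner_vec_def sum_negf)

lemma torus_char_add: "torus_char (k + l) x = torus_char k x * torus_char l x"
  by (simp add: torus_char_def freq_def inner_vec_def algebra_simps sum.distrib flip: exp_add)

lemma continuous_on_torus_char: "continuous_on A (torus_char k)"
  unfolding torus_char_def by (intro continuous_intros)

text \<open>
  Parseval: expand the conjugate factor of \<open>\<bar>f\<bar>\<^sup>2 = f cnj f\<close>; each of its characters extracts a Fourier
  coefficient of \<open>f\<close>.
\<close>

lemma L2_norm_torus_trig_poly:
  fixes a :: "int ^ 'n \<Rightarrow> complex"
  assumes "finite S"
  shows "L2_norm_torus (\<lambda>x. \<Sum>l\<in>S. a l * torus_char l x) =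
    sqrt ((2 * pi) ^ CARD('n) * (\<Sum>l\<in>S. (cmod (a l))\<^sup>2))"
proof -
  define f where "f = (\<lambda>x. \<Sum>l\<in>S. a l * torus_char l x)"
  have coeff: "(LINT x:torus_box|lborel. f x * torus_char (- l) x) = (2 * pi) ^ CARD('n) * a l"
    if "l \<in> S" for l
    using fourier_coeff_trig_poly[OF assms, of a l] that
    by (simp add: fourier_coeff_def f_def field_simps)
  have int: "set_integrable lborel torus_box (\<lambda>x. cnj (a l) * (f x * torus_char (- l) x))" for l
    unfolding torus_box_def set_integrable_def f_def
    by (rule borel_integrable_compact) (auto intro!: continuous_intros continuous_on_torus_char)
  have "complex_of_real (LINT x:torus_box|lborel. (cmod (f x))\<^sup>2) =
      (LINT x:torus_box|lborel. f x * cnj (f x))"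
    by (simp add: complex_norm_square del: of_real_power flip: set_integral_complex_of_real)
  also have "\<dots> = (LINT x:torus_box|lborel. (\<Sum>l\<in>S. cnj (a l) * (f x * torus_char (- l) x)))"
    unfolding f_def by (simp add: cnj_torus_char sum_distrib_left mult_ac)
  also have "\<dots> = (\<Sum>l\<in>S. LINT x:torus_box|lborel. cnj (a l) * (f x * torus_char (- l) x))"
    using int unfolding set_lebesgue_integral_def set_integrable_def
    by (simp add: scaleR_sum_right Bochner_Integration.integral_sum)
  also have "\<dots> = (\<Sum>l\<in>S. cnj (a l) * ((2 * pi) ^ CARD('n) * a l))"
    by (intro sum.cong refl) (simp add: coeff)
  also have "\<dots> = complex_of_real ((2 * pi) ^ CARD('n) * (\<Sum>l\<in>S. (cmod (a l))\<^sup>2))"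
    by (simp add: sum_distrib_left complex_norm_square mult_ac del: of_real_power)
  finally have "(LINT x:torus_box|lborel. (cmod (f x))\<^sup>2) = (2 * pi) ^ CARD('n) * (\<Sum>l\<in>S. (cmod (a l))\<^sup>2)"
    by (simp only: of_real_eq_iff)
  then show ?thesis by (simp add: L2_norm_torus_def f_def)
qed

text \<open>
  All summands carry the same coefficient \<open>b\<close>, so terms with equal frequency add up without cancellation and a
  lower bound on their number is a lower bound on the Fourier coefficient.
\<close>

lemma L2_norm_torus_ge_of_multiplicity:
  fixes \<kappa> :: "'i \<Rightarrow> int ^ 'n"
  assumes "finite I" "finite K" "0 \<le> \<rho>"
    and mult: "\<And>l. l \<in> K \<Longrightarrow> \<rho> \<le> real (card {i \<in> I. \<kappa> i = l})"
  shows "cmod b * sqrt ((2 * pi) ^ CARD('n) * real (card K)) * \<rho>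
    \<le> L2_norm_torus (\<lambda>x. \<Sum>i\<in>I. b * torus_char (\<kappa> i) x)"
proof -
  define r where "r l = real (card {i \<in> I. \<kappa> i = l})" for l
  have r0: "r l = 0" if "l \<notin> \<kappa> ` I" for l
  proof -
    have "{i \<in> I. \<kappa> i = l} = {}" using that by auto
    then show ?thesis unfolding r_def by (simp only: card.empty of_nat_0)
  qed
  have "(\<lambda>x. \<Sum>i\<in>I. b * torus_char (\<kappa> i) x) = (\<lambda>x. \<Sum>l\<in>\<kappa> ` I. (of_real (r l) * b) * torus_char l x)"
    by (rule ext, subst sum_torus_char_regroup[OF assms(1)]) (simp add: r_def)
  then have "L2_norm_torus (\<lambda>x. \<Sum>i\<in>I. b * torus_char (\<kappa> i) x) =
      sqrt ((2 * pi) ^ CARD('n) * (\<Sum>l\<in>\<kappa> ` I. (r l * cmod b)\<^sup>2))"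
    using assms(1) by (simp add: L2_norm_torus_trig_poly norm_mult r_def)
  moreover have "real (card K) * (\<rho> * cmod b)\<^sup>2 \<le> (\<Sum>l\<in>\<kappa> ` I. (r l * cmod b)\<^sup>2)"
  proof -
    have "real (card K) * (\<rho> * cmod b)\<^sup>2 \<le> (\<Sum>l\<in>K. (r l * cmod b)\<^sup>2)"
      using mult assms(3) by (intro sum_bounded_below power_mono mult_right_mono) (auto simp: r_def)
    also have "\<dots> = (\<Sum>l\<in>K \<inter> \<kappa> ` I. (r l * cmod b)\<^sup>2)"
      using assms(2) r0 by (intro sum.mono_neutral_right) auto
    also have "\<dots> \<le> (\<Sum>l\<in>\<kappa> ` I. (r l * cmod b)\<^sup>2)"
      using assms(1) by (intro sum_mono2) auto
    finally show ?thesis .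
  qed
  then have "sqrt ((2 * pi) ^ CARD('n) * (real (card K) * (\<rho> * cmod b)\<^sup>2)) \<le>
      sqrt ((2 * pi) ^ CARD('n) * (\<Sum>l\<in>\<kappa> ` I. (r l * cmod b)\<^sup>2))"
    by (intro real_sqrt_le_mono mult_left_mono) auto
  ultimately show ?thesis using assms(3)
    by (simp add: real_sqrt_mult mult_ac)
qed

text \<open>
  The phase \<open>q\<close> is a parameter separate from the frequency \<open>k\<close>, because a product of free waves, for which
  \<open>q = \<bar>k\<bar>\<^sup>2\<close>, is again of this form but in general with a different \<open>q\<close>.
\<close>

definition wave :: "nat \<Rightarrow> int \<Rightarrow> int ^ 'n \<Rightarrow> real \<Rightarrow> real ^ 'n \<Rightarrow> complex"
  where "wave m q k t x = exp (- \<i> * complex_of_real ((real m)\<^sup>2 * of_int q * t)) * torus_char (int m *s k) x"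

lemma wave_mult: "wave m q k t x * wave m q' k' t x = wave m (q + q') (k + k') t x"
  by (simp add: wave_def vector_add_ldistrib torus_char_add algebra_simps exp_add exp_diff exp_minus divide_inverse)

lemma cnj_wave: "cnj (wave m q k t x) = wave m (- q) (- k) t x"
proof -
  have "int m *s (- k) = - (int m *s k)" by (simp add: vec_eq_iff)
  then show ?thesis by (simp add: wave_def exp_cnj cnj_torus_char)
qed

lemma integral_exp_resonance:
  assumes "1 \<le> m"
  shows "(LINT t:{0..2 * pi / (real m)\<^sup>2}|lborel. exp (\<i> * complex_of_real ((real m)\<^sup>2 * of_int n * t))) =
    (if n = 0 then complex_of_real (2 * pi / (real m)\<^sup>2) else 0)"
proof -
  define c where "c = (real m)\<^sup>2"
  have c: "c > 0" using assms by (simp add: c_def)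
  define g where "g y = indicat_real {0..2 * pi} y *\<^sub>R exp (\<i> * complex_of_real (of_int n * y))" for y
  have "indicat_real {0..2 * pi / c} t *\<^sub>R exp (\<i> * complex_of_real (c * of_int n * t)) = g (0 + c * t)" for t
    using c by (simp add: g_def indicator_def zero_le_mult_iff field_simps)
  then have "(LINT t:{0..2 * pi / c}|lborel. exp (\<i> * complex_of_real (c * of_int n * t))) =
      (\<integral>t. g (0 + c * t) \<partial>lborel)"
    unfolding set_lebesgue_integral_def by (simp only:)
  also have "\<dots> = (1 / c) *\<^sub>R (\<integral>y. g y \<partial>lborel)"
    using c by (subst lborel_integral_real_affine[of c g 0]) auto
  also have "\<dots> = (if n = 0 then complex_of_real (2 * pi / c) else 0)"
    using integral_exp_period[of n] unfolding set_lebesgue_integral_def g_def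
    by (simp add: scaleR_conv_of_real)
  finally show ?thesis by (simp add: c_def)
qed

text \<open>
  After the propagator has acted, the term \<open>i\<close> depends on the time \<open>s\<close> of integration through
  \<open>exp (- \<i> \<bar>m \<sigma>(i)\<bar>\<^sup>2 (T - s)) exp (- \<i> m\<^sup>2 q(i) s)\<close>. Since \<open>m\<^sup>2 T = 2\<pi>\<close>, the factor coming from \<open>T\<close> is \<open>1\<close>, and
  what remains is a \<open>T\<close>-periodic exponential, which has mean zero unless \<open>q(i) = \<bar>\<sigma>(i)\<bar>\<^sup>2\<close>.
\<close>

lemma duhamel_eq_resonant_sum:
  fixes \<sigma> :: "'i \<Rightarrow> int ^ 'n"
  assumes "1 \<le> m" "finite I"
    and expansion: "\<And>t. nonlinearity (schroedinger t \<phi>) = (\<lambda>x. \<Sum>i\<in>I. \<beta> * wave m (q i) (\<sigma> i) t x)"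
  shows "duhamel \<mu> \<phi> (2 * pi / (real m)\<^sup>2) x =
    (\<Sum>i | i \<in> I \<and> q i = sq_norm (\<sigma> i).
      (- \<i> * of_real \<mu> * of_real (2 * pi / (real m)\<^sup>2) * \<beta>) * torus_char (int m *s \<sigma> i) x)"
proof -
  define T where "T = 2 * pi / (real m)\<^sup>2"
  define e where "e n t = exp (\<i> * complex_of_real ((real m)\<^sup>2 * of_int n * t))" for n t
  define c where "c i = torus_char (int m *s \<sigma> i) x" for i
  have mT: "(real m)\<^sup>2 * T = 2 * pi" using assms(1) by (simp add: T_def)
  have integrand: "schroedinger (T - t) (nonlinearity (schroedinger t \<phi>)) x =
      (\<Sum>i\<in>I. (\<beta> * c i) * e (sq_norm (\<sigma> i) - q i) t)" for t
  proof -
    have "nonlinearity (schroedinger t \<phi>) =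
        (\<lambda>x. \<Sum>i\<in>I. (\<beta> * exp (- \<i> * complex_of_real ((real m)\<^sup>2 * of_int (q i) * t))) * torus_char (int m *s \<sigma> i) x)"
      unfolding expansion wave_def by (simp add: mult_ac)
    moreover have "exp (- \<i> * complex_of_real (of_int (sq_norm (int m *s \<sigma> i)) * (T - t))) *
        exp (- \<i> * complex_of_real ((real m)\<^sup>2 * of_int (q i) * t)) = e (sq_norm (\<sigma> i) - q i) t" for i
    proof -
      have "of_int (sq_norm (int m *s \<sigma> i)) * (T - t) + (real m)\<^sup>2 * of_int (q i) * t =
          of_int (sq_norm (\<sigma> i)) * ((real m)\<^sup>2 * T) - (real m)\<^sup>2 * of_int (sq_norm (\<sigma> i) - q i) * t"
        by (simp add: sq_norm_scale algebra_simps)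
      also have "\<dots> = of_int (sq_norm (\<sigma> i)) * (2 * pi) - (real m)\<^sup>2 * of_int (sq_norm (\<sigma> i) - q i) * t"
        by (simp only: mT)
      finally have phase: "of_int (sq_norm (int m *s \<sigma> i)) * (T - t) + (real m)\<^sup>2 * of_int (q i) * t = \<dots>" .
      have "exp (- \<i> * complex_of_real (of_int (sq_norm (int m *s \<sigma> i)) * (T - t))) *
        exp (- \<i> * complex_of_real ((real m)\<^sup>2 * of_int (q i) * t)) =
        exp (- \<i> * complex_of_real (of_int (sq_norm (int m *s \<sigma> i)) * (T - t) + (real m)\<^sup>2 * of_int (q i) * t))"
        unfolding exp_add[symmetric] of_real_add by (simp only: distrib_left)
      also have "\<dots> = exp (2 * pi * of_int (- sq_norm (\<sigma> i)) * \<i>) * e (sq_norm (\<sigma> i) - q i) t"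
        unfolding phase e_def exp_add[symmetric] by (simp add: algebra_simps)
      also have "exp (2 * pi * of_int (- sq_norm (\<sigma> i)) * \<i>) = 1"
        using exp_integer_2pi[of "of_int (- sq_norm (\<sigma> i))"] by (simp add: mult_ac)
      finally show ?thesis by simp
    qed
    ultimately show ?thesis
      by (simp add: schroedinger_char_sum[OF assms(2)] c_def) (simp add: mult_ac)
  qed
  have int: "set_integrable lborel {0..T} (\<lambda>t. b * e n t)" for b n
    unfolding e_def by (rule borel_integrable_atLeastAtMost') (intro continuous_intros)
  have "(LINT t:{0..T}|lborel. schroedinger (T - t) (nonlinearity (schroedinger t \<phi>)) x) =
      (\<Sum>i\<in>I. LINT t:{0..T}|lborel. (\<beta> * c i) * e (sq_norm (\<sigma> i) - q i) t)"
    unfolding integrand using int unfolding set_lebesgue_integral_def set_integrable_def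
    by (simp add: scaleR_sum_right Bochner_Integration.integral_sum)
  also have "\<dots> = (\<Sum>i\<in>I. (\<beta> * c i) * (if sq_norm (\<sigma> i) - q i = 0 then of_real T else 0))"
    unfolding set_integral_mult_right e_def T_def integral_exp_resonance[OF assms(1)] ..
  also have "\<dots> = (\<Sum>i | i \<in> I \<and> q i = sq_norm (\<sigma> i). of_real T * \<beta> * c i)"
    using assms(2) by (subst sum.inter_filter) (auto intro!: sum.cong)
  finally show ?thesis
    by (simp add: duhamel_def T_def c_def sum_distrib_left mult_ac)
qed

lemma duhamel_L2_lower_bound:
  fixes \<sigma> :: "'i \<Rightarrow> int ^ 'n"
  assumes "1 \<le> m" "finite I" "finite K" "0 \<le> \<rho>" "0 \<le> \<beta>" "\<bar>\<mu>\<bar> = 1"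
    and expansion: "\<And>t. nonlinearity (schroedinger t \<phi>) = (\<lambda>x. \<Sum>i\<in>I. of_real \<beta> * wave m (q i) (\<sigma> i) t x)"
    and mult: "\<And>k. k \<in> K \<Longrightarrow> \<rho> \<le> real (card {i \<in> I. \<sigma> i = k \<and> q i = sq_norm k})"
  shows "2 * pi / (real m)\<^sup>2 * \<beta> * sqrt ((2 * pi) ^ CARD('n) * real (card K)) * \<rho>
    \<le> L2_norm_torus (duhamel \<mu> \<phi> (2 * pi / (real m)\<^sup>2))"
proof -
  define J where "J = {i \<in> I. q i = sq_norm (\<sigma> i)}"
  define b where "b = - \<i> * of_real \<mu> * of_real (2 * pi / (real m)\<^sup>2) * complex_of_real \<beta>"
  have inj: "inj ((*s) (int m) :: int ^ 'n \<Rightarrow> _)"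
    using assms(1) by (auto simp: inj_on_def vec_eq_iff)
  have "cmod b * sqrt ((2 * pi) ^ CARD('n) * real (card ((*s) (int m) ` K))) * \<rho>
      \<le> L2_norm_torus (\<lambda>x. \<Sum>i\<in>J. b * torus_char (int m *s \<sigma> i) x)"
  proof (rule L2_norm_torus_ge_of_multiplicity)
    fix l assume "l \<in> (*s) (int m) ` K"
    then obtain k where k: "k \<in> K" "l = int m *s k" by auto
    have "{i \<in> J. int m *s \<sigma> i = l} = {i \<in> I. \<sigma> i = k \<and> q i = sq_norm k}"
      using injD[OF inj] by (auto simp: J_def k(2))
    then show "\<rho> \<le> real (card {i \<in> J. int m *s \<sigma> i = l})" using mult[OF k(1)] by simp
  qed (use assms in \<open>auto simp: J_def\<close>)
  moreover have "duhamel \<mu> \<phi> (2 * pi / (real m)\<^sup>2) = (\<lambda>x. \<Sum>i\<in>J. b * torus_char (int m *s \<sigma> i) x)"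
    using duhamel_eq_resonant_sum[OF assms(1,2) expansion] by (simp add: fun_eq_iff J_def b_def)
  moreover have "cmod b = 2 * pi / (real m)\<^sup>2 * \<beta>"
    using assms by (simp add: b_def norm_mult norm_divide norm_power)
  moreover have "card ((*s) (int m) ` K) = card K"
    using inj by (intro card_image) (rule inj_on_subset, auto)
  ultimately show ?thesis by simp
qed

lemma finite_freq_box: "finite (freq_box N :: (int ^ 'n) set)"
  and card_freq_box: "card (freq_box N :: (int ^ 'n) set) = (2 * N + 1) ^ CARD('n)"
proof -
  have eq: "(freq_box N :: (int ^ 'n) set) = vec_lambda ` (UNIV \<rightarrow>\<^sub>E {- int N..int N})"
  proof (intro set_eqI iffI)
    fix k :: "int ^ 'n" assume "k \<in> freq_box N"
    then have "($) k \<in> UNIV \<rightarrow>\<^sub>E {- int N..int N}"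
      by (simp add: freq_box_def PiE_iff abs_le_iff minus_le_iff)
    then show "k \<in> vec_lambda ` (UNIV \<rightarrow>\<^sub>E {- int N..int N})"
      by (rule rev_image_eqI) simp
  qed (auto simp: freq_box_def PiE_iff abs_le_iff minus_le_iff)
  show "finite (freq_box N :: (int ^ 'n) set)"
    unfolding eq by (intro finite_imageI finite_PiE) auto
  have "inj_on (vec_lambda :: _ \<Rightarrow> int ^ 'n) (UNIV \<rightarrow>\<^sub>E {- int N..int N})"
    by (simp add: inj_on_def vec_lambda_inject)
  then show "card (freq_box N :: (int ^ 'n) set) = (2 * N + 1) ^ CARD('n)"
    unfolding eq by (simp add: card_image card_funcsetE nat_add_distrib nat_mult_distrib)
qed

section \<open>Expansion of the nonlinearity into plane waves\<close>

text \<open>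
  Multiplication of a sum of waves by \<open>\<bar>u\<bar>\<^sup>2 = u cnj u\<close> appends two frequencies \<open>k\<close> and \<open>l\<close> to every index, the
  second one with a minus sign. The indexing data are kept in this composable form because the quintic
  nonlinearity is obtained by multiplying by \<open>\<bar>u\<bar>\<^sup>2\<close> twice.
\<close>

definition cubic_freq :: "('i \<Rightarrow> int ^ 'n) \<Rightarrow> 'i \<times> (int ^ 'n) \<times> (int ^ 'n) \<Rightarrow> int ^ 'n"
  where "cubic_freq \<sigma> = (\<lambda>(i, k, l). \<sigma> i + k - l)"

definition cubic_phase :: "('i \<Rightarrow> int) \<Rightarrow> 'i \<times> (int ^ 'n) \<times> (int ^ 'n) \<Rightarrow> int"
  where "cubic_phase q = (\<lambda>(i, k, l). q i + sq_norm k - sq_norm l)"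

lemma cubic_expansion:
  fixes \<sigma> :: "'i \<Rightarrow> int ^ 'n"
  assumes u: "u = c * (\<Sum>k\<in>B. wave m (sq_norm k) k t x)"
    and v: "v = b * (\<Sum>i\<in>I. wave m (q i) (\<sigma> i) t x)"
  shows "u * cnj u * v = c * cnj c * b *
    (\<Sum>p\<in>I \<times> B \<times> B. wave m (cubic_phase q p) (cubic_freq \<sigma> p) t x)"
proof -
  have "(\<Sum>p\<in>I \<times> B \<times> B. wave m (cubic_phase q p) (cubic_freq \<sigma> p) t x) =
      (\<Sum>(i, k, l)\<in>I \<times> B \<times> B. wave m (q i) (\<sigma> i) t x * (wave m (sq_norm k) k t x * cnj (wave m (sq_norm l) l t x)))"
    by (intro sum.cong refl) (auto simp: cubic_phase_def cubic_freq_def cnj_wave wave_mult add_diff_eq)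
  also have "\<dots> = (\<Sum>i\<in>I. wave m (q i) (\<sigma> i) t x) *
      ((\<Sum>k\<in>B. wave m (sq_norm k) k t x) * cnj (\<Sum>l\<in>B. wave m (sq_norm l) l t x))"
    by (simp add: sum_product sum.cartesian_product case_prod_beta)
  finally show ?thesis by (simp add: u v mult_ac)
qed

lemma nonlinearity_dim_2:
  fixes u :: "real ^ 'n \<Rightarrow> complex"
  assumes "CARD('n) = 2"
  shows "nonlinearity u x = u x * cnj (u x) * u x"
  by (simp add: nonlinearity_def assms complex_norm_square[symmetric])

lemma nonlinearity_dim_1:
  fixes u :: "real ^ 'n \<Rightarrow> complex"
  assumes "CARD('n) = 1"
  shows "nonlinearity u x = u x * cnj (u x) * (u x * cnj (u x) * u x)"
  by (simp add: nonlinearity_def assms complex_norm_square[symmetric] flip: power_add mult.assoc)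

section \<open>The data \<open>\<phi>\<^sub>m\<^sub>,\<^sub>N\<close>\<close>

lemma phi_eq_char_sum:
  "phi m N = (\<lambda>x::real^'n. \<Sum>k\<in>freq_box N. complex_of_real (real N powr (- (real CARD('n) / 2))) * torus_char (int m *s k) x)"
proof -
  have "freq (int m *s k) = real m *\<^sub>R freq k" for k :: "int ^ 'n"
    by (simp add: freq_def vec_eq_iff)
  then show ?thesis
    by (simp add: fun_eq_iff phi_def torus_char_def sum_distrib_left)
qed

lemma schroedinger_phi:
  "schroedinger t (phi m N) x = complex_of_real (real N powr (- (real CARD('n) / 2))) *
    (\<Sum>k\<in>freq_box N. wave m (sq_norm k) k t (x :: real ^ 'n))"
  unfolding phi_eq_char_sum schroedinger_char_sum[OF finite_freq_box]
  by (simp add: wave_def sum_distrib_left sq_norm_scale mult_ac)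

lemma L2_norm_phi:
  assumes "1 \<le> m" "1 \<le> N"
  shows "L2_norm_torus (phi m N :: real ^ 'n \<Rightarrow> complex) = sqrt ((2 * pi * (2 + 1 / real N)) ^ CARD('n))"
proof -
  define \<alpha> where "\<alpha> = real N powr (- (real CARD('n) / 2))"
  have inj: "inj_on ((*s) (int m)) (freq_box N :: (int ^ 'n) set)"
    using assms(1) by (auto simp: inj_on_def vec_eq_iff)
  have "phi m N = (\<lambda>x::real^'n. \<Sum>l\<in>(*s) (int m) ` freq_box N. complex_of_real \<alpha> * torus_char l x)"
    unfolding phi_eq_char_sum by (simp add: sum.reindex[OF inj] \<alpha>_def)
  then have "L2_norm_torus (phi m N :: real ^ 'n \<Rightarrow> complex) =
      sqrt ((2 * pi) ^ CARD('n) * (real ((2 * N + 1) ^ CARD('n)) * \<alpha>\<^sup>2))"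
    by (simp add: L2_norm_torus_trig_poly finite_freq_box card_image[OF inj] card_freq_box)
  also have "\<alpha>\<^sup>2 = 1 / real N ^ CARD('n)"
  proof -
    have "\<alpha>\<^sup>2 = real N powr (- real CARD('n))"
      by (simp add: \<alpha>_def power2_eq_square flip: powr_add)
    then show ?thesis using assms(2) by (simp add: powr_minus powr_realpow divide_inverse)
  qed
  also have "(2 * pi) ^ CARD('n) * (real ((2 * N + 1) ^ CARD('n)) * (1 / real N ^ CARD('n))) =
      (2 * pi * (2 + 1 / real N)) ^ CARD('n)"
  proof -
    have "2 + 1 / real N = real (2 * N + 1) / real N" using assms(2) by (simp add: field_simps)
    then show ?thesis by (simp only: power_mult_distrib power_divide of_nat_power) simp
  qed
  finally show ?thesis .
qed

section \<open>Resonant tuples from orthogonal pairs\<close>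

lemma plus_mem_freq_box:
  assumes "k \<in> freq_box (N div 2)" "\<And>j. 2 * \<bar>h $ j\<bar> \<le> int N"
  shows "k + h \<in> freq_box N"
  unfolding freq_box_def mem_Collect_eq
proof
  fix j
  have "\<bar>k $ j\<bar> \<le> int (N div 2)" using assms(1) by (simp add: freq_box_def)
  moreover have "2 * int (N div 2) \<le> int N" by simp
  ultimately show "\<bar>(k + h) $ j\<bar> \<le> int N"
    using assms(2)[of j] unfolding vector_add_component by linarith
qed

text \<open>
  For orthogonal \<open>u\<close> and \<open>v\<close> the points \<open>k, k + u, k + u + v, k + v\<close> are the vertices of a rectangle, and
  \<open>\<bar>k + u\<bar>\<^sup>2 + \<bar>k + v\<bar>\<^sup>2 - \<bar>k + u + v\<bar>\<^sup>2 - \<bar>k\<bar>\<^sup>2 = - 2 u \<bullet> v\<close>.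
\<close>

lemma orthogonal_pairs_le_cubic_resonances:
  fixes k :: "int ^ 'n"
  assumes d: "CARD('n) = 2" and k: "k \<in> freq_box (N div 2)"
  shows "card (orthogonal_pairs (N div 6)) \<le>
    card {i \<in> freq_box N \<times> freq_box N \<times> freq_box N.
      cubic_freq (\<lambda>k. k) i = k \<and> cubic_phase sq_norm i = sq_norm k}"
    (is "_ \<le> card ?R")
proof -
  obtain i j :: 'n where ij: "UNIV = {i, j}" "i \<noteq> j"
    using d unfolding card_2_iff by auto
  define vec where "vec a b = (\<chi> s. if s = i then a else b)" for a b :: int
  have vec: "vec a b $ i = a" "vec a b $ j = b" for a b
    using ij by (auto simp: vec_def)
  have all: "(\<forall>s. P s) \<longleftrightarrow> P i \<and> P j" for P using ij(1) by (metis UNIV_I insertE singletonD)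
  define f where "f = (\<lambda>(a, b, c, d). (k + vec a b, k + vec c d, k + (vec a b + vec c d)))"
  show ?thesis
  proof (rule card_inj_on_le)
    show "inj_on f (orthogonal_pairs (N div 6))"
    proof (rule inj_onI)
      fix x y assume "f x = f y"
      then show "x = y"
        by (cases x, cases y) (auto simp: f_def vec_eq_iff all vec)
    qed
    show "f ` orthogonal_pairs (N div 6) \<subseteq> ?R"
    proof (rule image_subsetI)
      fix z assume z: "z \<in> orthogonal_pairs (N div 6)"
      obtain a b c d where z_eq: "z = (a, b, c, d)" by (metis prod_cases4)
      with z have abcd: "(a, b, c, d) \<in> orthogonal_pairs (N div 6)" by simp
      have "6 * int (N div 6) \<le> int N" by simp
      then have "6 * \<bar>a\<bar> \<le> int N" "6 * \<bar>b\<bar> \<le> int N" "6 * \<bar>c\<bar> \<le> int N" "6 * \<bar>d\<bar> \<le> int N"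
        using abcd unfolding orthogonal_pairs_def by auto
      then have bounds: "- int N \<le> 6 * a" "6 * a \<le> int N" "- int N \<le> 6 * b" "6 * b \<le> int N"
          "- int N \<le> 6 * c" "6 * c \<le> int N" "- int N \<le> 6 * d" "6 * d \<le> int N"
        by simp_all
      have ortho: "a * c + b * d = 0" using abcd by (simp add: orthogonal_pairs_def)
      have sums: "2 * \<bar>a + c\<bar> \<le> int N" "2 * \<bar>b + d\<bar> \<le> int N"
        using bounds by (auto simp: abs_if)
      have "2 * \<bar>vec a b $ s\<bar> \<le> int N" "2 * \<bar>vec c d $ s\<bar> \<le> int N" "2 * \<bar>(vec a b + vec c d) $ s\<bar> \<le> int N" for s
        using bounds sums by (auto simp: vec_def)
      then have "f (a, b, c, d) \<in> freq_box N \<times> freq_box N \<times> freq_box N"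
        by (simp add: f_def plus_mem_freq_box[OF k])
      moreover have "sq_norm (k + vec a b) + sq_norm (k + vec c d) - sq_norm (k + (vec a b + vec c d)) = sq_norm k"
      proof -
        have "sq_norm l = (l $ i)\<^sup>2 + (l $ j)\<^sup>2" for l :: "int ^ 'n"
          unfolding sq_norm_def ij(1) using ij(2) by simp
        then have "sq_norm (k + vec a b) + sq_norm (k + vec c d) - sq_norm (k + (vec a b + vec c d)) - sq_norm k
            = - 2 * (a * c + b * d)"
          by (simp add: vec power2_eq_square algebra_simps)
        then show ?thesis using ortho by simp
      qed
      ultimately show "f z \<in> ?R" by (simp add: z_eq f_def cubic_freq_def cubic_phase_def)
    qed
  qed (simp add: finite_freq_box)
qed

text \<open>
  After the shift by \<open>k\<close> the resonance condition reads \<open>x + y + z = u + v\<close>, \<open>x\<^sup>2 + y\<^sup>2 + z\<^sup>2 = u\<^sup>2 + v\<^sup>2\<close>. With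
  \<open>a = x - u\<close> and \<open>b = y - v\<close> the first equation is \<open>z = - a - b\<close>, and the second one becomes
  \<open>a (a + b + u) + b (b + v) = 0\<close>. Thus \<open>c = a + b + u\<close> and \<open>d = b + v\<close> give the equation \<open>a c + b d = 0\<close>, and
  solving for the original unknowns yields \<open>x = c - b\<close>, \<open>y = d\<close>, \<open>u = c - a - b\<close>, \<open>v = d - b\<close>. These are sums of at
  most three of the parameters, whence the bound \<open>N div 6\<close> on the latter for shifts of size \<open>N / 2\<close>.
\<close>

lemma orthogonal_pairs_le_quintic_resonances:
  fixes k :: "int ^ 'n"
  assumes d: "CARD('n) = 1" and k: "k \<in> freq_box (N div 2)"
  shows "card (orthogonal_pairs (N div 6)) \<le>
    card {i \<in> (freq_box N \<times> freq_box N \<times> freq_box N) \<times> freq_box N \<times> freq_box N.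
      cubic_freq (cubic_freq (\<lambda>k. k)) i = k \<and> cubic_phase (cubic_phase sq_norm) i = sq_norm k}"
    (is "_ \<le> card ?R")
proof -
  obtain i :: 'n where i: "UNIV = {i}"
    using d by (elim card_1_singletonE)
  define vec where "vec a = (\<chi> s::'n. a)" for a :: int
  have vec: "vec a $ s = a" for a s by (simp add: vec_def)
  define f where "f = (\<lambda>(a, b, c, d). ((k + vec (c - b), k + vec d, k + vec (c - a - b)),
    k + vec (- a - b), k + vec (d - b)))"
  show ?thesis
  proof (rule card_inj_on_le)
    show "inj_on f (orthogonal_pairs (N div 6))"
    proof (rule inj_onI)
      fix x y assume "f x = f y"
      then show "x = y"
        by (cases x, cases y) (auto simp: f_def vec_eq_iff vec)
    qed
    show "f ` orthogonal_pairs (N div 6) \<subseteq> ?R"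
    proof (rule image_subsetI)
      fix z assume z: "z \<in> orthogonal_pairs (N div 6)"
      obtain a b c d where z_eq: "z = (a, b, c, d)" by (metis prod_cases4)
      with z have abcd: "(a, b, c, d) \<in> orthogonal_pairs (N div 6)" by simp
      have "6 * int (N div 6) \<le> int N" by simp
      then have "6 * \<bar>a\<bar> \<le> int N" "6 * \<bar>b\<bar> \<le> int N" "6 * \<bar>c\<bar> \<le> int N" "6 * \<bar>d\<bar> \<le> int N"
        using abcd unfolding orthogonal_pairs_def by auto
      then have bounds: "- int N \<le> 6 * a" "6 * a \<le> int N" "- int N \<le> 6 * b" "6 * b \<le> int N"
          "- int N \<le> 6 * c" "6 * c \<le> int N" "- int N \<le> 6 * d" "6 * d \<le> int N"
        by simp_all
      have ortho: "a * c + b * d = 0" using abcd by (simp add: orthogonal_pairs_def)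
      have "2 * \<bar>c - b\<bar> \<le> int N" "2 * \<bar>d\<bar> \<le> int N" "2 * \<bar>c - a - b\<bar> \<le> int N"
          "2 * \<bar>- a - b\<bar> \<le> int N" "2 * \<bar>d - b\<bar> \<le> int N"
        using bounds by (auto simp: abs_if)
      then have "f (a, b, c, d) \<in> (freq_box N \<times> freq_box N \<times> freq_box N) \<times> freq_box N \<times> freq_box N"
        by (simp add: f_def plus_mem_freq_box[OF k] vec)
      moreover have "k + vec (c - b) + (k + vec d) - (k + vec (c - a - b)) + (k + vec (- a - b)) - (k + vec (d - b)) = k"
        by (simp add: vec_eq_iff vec)
      moreover have "sq_norm (k + vec (c - b)) + sq_norm (k + vec d) - sq_norm (k + vec (c - a - b))
          + sq_norm (k + vec (- a - b)) - sq_norm (k + vec (d - b)) = sq_norm k"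
      proof -
        have "sq_norm l = (l $ i)\<^sup>2" for l :: "int ^ 'n"
          unfolding sq_norm_def i by simp
        then have "sq_norm (k + vec (c - b)) + sq_norm (k + vec d) - sq_norm (k + vec (c - a - b))
          + sq_norm (k + vec (- a - b)) - sq_norm (k + vec (d - b)) - sq_norm k = 2 * (a * c + b * d)"
          by (simp add: vec power2_eq_square algebra_simps)
        then show ?thesis using ortho by simp
      qed
      ultimately show "f z \<in> ?R" by (simp add: z_eq f_def cubic_freq_def cubic_phase_def)
    qed
  qed (simp add: finite_freq_box)
qed

section \<open>The logarithmic lower bound\<close>

text \<open>
  The exponent \<open>- d/2 - 2\<close> is \<open>- d p / 2\<close> for both values of \<open>d\<close>. The powers of \<open>N\<close> balance:
  \<open>N\<^bsup>-d/2-2\<^esup>\<close> from the coefficients, \<open>N\<^bsup>d/2\<^esup>\<close> from the number of frequencies and \<open>N\<^sup>2\<close> from the number of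
  resonances.
\<close>

lemma duhamel_phi_log_bound:
  fixes \<sigma> :: "'i \<Rightarrow> int ^ 'n"
  assumes "1 \<le> m" "1 \<le> N" "\<bar>\<mu>\<bar> = 1" "finite I"
    and expansion: "\<And>t. nonlinearity (schroedinger t (phi m N)) =
      (\<lambda>x. of_real (real N powr (- (real CARD('n) / 2) - 2)) * (\<Sum>i\<in>I. wave m (q i) (\<sigma> i) t x))"
    and mult: "\<And>k. k \<in> freq_box (N div 2) \<Longrightarrow>
      card (orthogonal_pairs (N div 6)) \<le> card {i \<in> I. \<sigma> i = k \<and> q i = sq_norm k}"
  shows "1 / 1224 / (real m)\<^sup>2 * ln (real N)
    \<le> L2_norm_torus (duhamel \<mu> (phi m N :: real ^ 'n \<Rightarrow> complex) (2 * pi / (real m)\<^sup>2))"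
proof -
  define \<beta> where "\<beta> = real N powr (- (real CARD('n) / 2) - 2)"
  define \<rho> where "\<rho> = (real N)\<^sup>2 * ln (real N) / 1224"
  define K where "K = (freq_box (N div 2) :: (int ^ 'n) set)"
  have N: "0 < real N" using assms(2) by simp
  have \<rho>: "0 \<le> \<rho>" using assms(2) by (simp add: \<rho>_def)
  have "real N ^ CARD('n) \<le> real (card K)"
  proof -
    have "N ^ CARD('n) \<le> (2 * (N div 2) + 1) ^ CARD('n)" by (intro power_mono) auto
    then show ?thesis unfolding K_def card_freq_box by (metis of_nat_le_iff of_nat_power)
  qed
  then have "real N ^ CARD('n) \<le> (2 * pi) ^ CARD('n) * real (card K)"
    using one_le_power[of "2 * pi" "CARD('n)"] pi_gt3 mult_mono[of 1 "(2 * pi) ^ CARD('n)" "real N ^ CARD('n)" "real (card K)"]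
    by simp
  then have "sqrt (real N ^ CARD('n)) \<le> sqrt ((2 * pi) ^ CARD('n) * real (card K))"
    by (rule real_sqrt_le_mono)
  moreover have "sqrt (real N ^ CARD('n)) = real N powr (real CARD('n) / 2)"
    using N by (simp add: powr_half_sqrt[symmetric] powr_realpow[symmetric] powr_powr)
  ultimately have K: "real N powr (real CARD('n) / 2) \<le> sqrt ((2 * pi) ^ CARD('n) * real (card K))"
    by simp
  have "1 / 1224 / (real m)\<^sup>2 * ln (real N) = 1 / (real m)\<^sup>2 * (ln (real N) / 1224)"
    by simp
  also have "\<dots> \<le> 2 * pi / (real m)\<^sup>2 * (ln (real N) / 1224)"
    using assms(2) pi_gt3 by (intro mult_right_mono divide_right_mono) auto
  also have "ln (real N) / 1224 = \<beta> * real N powr (real CARD('n) / 2) * \<rho>"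
  proof -
    have "\<beta> * real N powr (real CARD('n) / 2) * real N powr 2 = 1"
      using N unfolding \<beta>_def powr_add[symmetric] by simp
    moreover have "real N powr 2 = (real N)\<^sup>2" by simp
    ultimately have "\<beta> * real N powr (real CARD('n) / 2) * (real N)\<^sup>2 = 1" by (simp only:)
    then show ?thesis by (simp add: \<rho>_def)
  qed
  also have "2 * pi / (real m)\<^sup>2 * (\<beta> * real N powr (real CARD('n) / 2) * \<rho>)
      \<le> 2 * pi / (real m)\<^sup>2 * (\<beta> * sqrt ((2 * pi) ^ CARD('n) * real (card K)) * \<rho>)"
    using K \<rho> by (intro mult_left_mono mult_right_mono) (auto simp: \<beta>_def)
  also have "\<dots> = 2 * pi / (real m)\<^sup>2 * \<beta> * sqrt ((2 * pi) ^ CARD('n) * real (card K)) * \<rho>"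
    by simp
  also have "\<dots> \<le> L2_norm_torus (duhamel \<mu> (phi m N :: real ^ 'n \<Rightarrow> complex) (2 * pi / (real m)\<^sup>2))"
  proof (rule duhamel_L2_lower_bound[OF assms(1,4) _ \<rho> _ assms(3)])
    show "nonlinearity (schroedinger t (phi m N)) = (\<lambda>x. \<Sum>i\<in>I. of_real \<beta> * wave m (q i) (\<sigma> i) t x)" for t
      by (simp add: expansion \<beta>_def sum_distrib_left)
    fix k assume "k \<in> K"
    then have "card (orthogonal_pairs (N div 6)) \<le> card {i \<in> I. \<sigma> i = k \<and> q i = sq_norm k}"
      unfolding K_def by (rule mult)
    then show "\<rho> \<le> real (card {i \<in> I. \<sigma> i = k \<and> q i = sq_norm k})"
      using card_orthogonal_pairs_ge[OF assms(2)] by (simp add: \<rho>_def)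
  qed (auto simp: K_def finite_freq_box \<beta>_def)
  finally show ?thesis .
qed

theorem theorem1p2:
  fixes \<mu> :: real
  assumes "CARD('n::finite) \<in> {1, 2}"
    and "\<mu> \<in> {1, -1}"
  shows "\<exists>c C. 0 < c \<and> c \<le> C \<and>
    (\<forall>m N. 1 \<le> m \<and> 1 \<le> N \<longrightarrow>
      c \<le> L2_norm_torus (phi m N :: real ^ 'n \<Rightarrow> complex) \<and>
      L2_norm_torus (phi m N :: real ^ 'n \<Rightarrow> complex) \<le> C \<and>
      L2_norm_torus (duhamel \<mu> (phi m N :: real ^ 'n \<Rightarrow> complex) (2 * pi / (real m)\<^sup>2))
        \<ge> c / (real m)\<^sup>2 * ln (real N))"
proof -
  define C where "C = sqrt ((2 * pi * 3) ^ CARD('n))"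
  have norm_bounds: "1 \<le> L2_norm_torus (phi m N :: real ^ 'n \<Rightarrow> complex) \<and>
      L2_norm_torus (phi m N :: real ^ 'n \<Rightarrow> complex) \<le> C" if "1 \<le> m" "1 \<le> N" for m N
  proof -
    have "2 * pi * (2 + 1 / real N) \<le> 2 * pi * 3"
      using that(2) by (intro mult_left_mono) auto
    moreover have "1 * 1 \<le> 2 * pi * (2 + 1 / real N)"
      using pi_gt3 by (intro mult_mono) auto
    ultimately show ?thesis
      unfolding L2_norm_phi[OF that] C_def
      by (intro conjI real_sqrt_le_mono power_mono real_sqrt_ge_one one_le_power) auto
  qed
  have log_bound: "1 / 1224 / (real m)\<^sup>2 * ln (real N)
      \<le> L2_norm_torus (duhamel \<mu> (phi m N :: real ^ 'n \<Rightarrow> complex) (2 * pi / (real m)\<^sup>2))"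
    if mN: "1 \<le> m" "1 \<le> N" for m N
  proof -
    define \<alpha> where "\<alpha> = real N powr (- (real CARD('n) / 2))"
    define B where "B = (freq_box N :: (int ^ 'n) set)"
    have fin: "finite B" by (simp add: B_def finite_freq_box)
    have u: "schroedinger t (phi m N) x = of_real \<alpha> * (\<Sum>k\<in>B. wave m (sq_norm k) k t x)"
      for t and x :: "real ^ 'n"
      by (simp add: schroedinger_phi \<alpha>_def B_def)
    have abs_mu: "\<bar>\<mu>\<bar> = 1" using assms(2) by auto
    consider "CARD('n) = 1" | "CARD('n) = 2" using assms(1) by auto
    then show ?thesis
    proof cases
      case 1
      have \<alpha>: "\<alpha> * \<alpha> * (\<alpha> * \<alpha> * \<alpha>) = real N powr (- (real CARD('n) / 2) - 2)"
        unfolding \<alpha>_def powr_add[symmetric] by (simp add: 1)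
      show ?thesis
      proof (rule duhamel_phi_log_bound[OF mN abs_mu, where I = "(B \<times> B \<times> B) \<times> B \<times> B"])
        show "nonlinearity (schroedinger t (phi m N)) =
            (\<lambda>x. of_real (real N powr (- (real CARD('n) / 2) - 2)) *
              (\<Sum>p\<in>(B \<times> B \<times> B) \<times> B \<times> B. wave m (cubic_phase (cubic_phase sq_norm) p) (cubic_freq (cubic_freq (\<lambda>k. k)) p) t x))" for t
          unfolding nonlinearity_dim_1[OF 1] cubic_expansion[OF u cubic_expansion[OF u u]] \<alpha>[symmetric]
          by simp
      qed (use fin orthogonal_pairs_le_quintic_resonances[OF 1] in \<open>auto simp: B_def\<close>)
    next
      case 2
      have \<alpha>: "\<alpha> * \<alpha> * \<alpha> = real N powr (- (real CARD('n) / 2) - 2)"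
        unfolding \<alpha>_def powr_add[symmetric] by (simp add: 2)
      show ?thesis
      proof (rule duhamel_phi_log_bound[OF mN abs_mu, where I = "B \<times> B \<times> B"])
        show "nonlinearity (schroedinger t (phi m N)) =
            (\<lambda>x. of_real (real N powr (- (real CARD('n) / 2) - 2)) *
              (\<Sum>p\<in>B \<times> B \<times> B. wave m (cubic_phase sq_norm p) (cubic_freq (\<lambda>k. k) p) t x))" for t
          unfolding nonlinearity_dim_2[OF 2] cubic_expansion[OF u u] \<alpha>[symmetric]
          by simp
      qed (use fin orthogonal_pairs_le_cubic_resonances[OF 2] in \<open>auto simp: B_def\<close>)
    qed
  qed
  show ?thesis
  proof (intro exI conjI allI impI)
    show "(1 / 1224 :: real) \<le> C" using norm_bounds[of 1 1] by simp
    fix m N :: nat assume "1 \<le> m \<and> 1 \<le> N"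
    then have mN: "1 \<le> m" "1 \<le> N" by simp_all
    show "1 / 1224 \<le> L2_norm_torus (phi m N :: real ^ 'n \<Rightarrow> complex)"
      using norm_bounds[OF mN] by simp
    show "L2_norm_torus (phi m N :: real ^ 'n \<Rightarrow> complex) \<le> C"
      using norm_bounds[OF mN] by simp
    show "1 / 1224 / (real m)\<^sup>2 * ln (real N)
        \<le> L2_norm_torus (duhamel \<mu> (phi m N :: real ^ 'n \<Rightarrow> complex) (2 * pi / (real m)\<^sup>2))"
      by (rule log_bound[OF mN])
  qed simp
qed

end
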